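(* Fix integers $m \ge r \ge 2$ and a nondegenerate $r$-graph $F$ on $m$ vertices. Suppose that there exists a constant $c>0$ such that for all sufficiently large $n \in \mathbb{N}$: (a) every $F$-free $r$-graph $\mathcal{H}$ on $n$ vertices with average degree $d(\mathcal{H}) \ge d(n,F) - c\binom{n}{r-1}$ satisfies $\Delta(\mathcal{H}) \le d(n,F) + \frac{1-\pi(F)}{4m}\binom{n}{r-1}$; and (b) $\left|\delta(n,F) - d(n-1,F)\right| \le \frac{1-\pi(F)}{8m}\binom{n}{r-1}$. Then there exists $N_0$ such that for all integers $n \ge N_0$ and all integers $t\ge 0$ with $t \le \min\left\{\frac{c}{4erm}n, \frac{1-\pi(F)}{64rm^2}n\right\}$ the following holds: if a collection $\{\mathcal{H}_1,\dots,\mathcal{H}_{t+1}\}$ of $n$-vertex $r$-graphs on the same vertex set satisfies \[ |\mathcal{H}_i| > \binom{n}{r}-\binom{n-t}{r} + \mathrm{ex}(n-t,F) \quad \text{for all } i \in [t+1], \] then $\{\mathcal{H}_1,\dots,\mathcal{H}_{t+1}\}$ contains a rainbow $F$-matching.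
   Context: An $r$-graph is a collection of $r$-element subsets (edges) of a finite vertex set. $\mathrm{ex}(n,F)$ is the maximum number of edges of an $n$-vertex $r$-graph not containing $F$ as a subgraph. $\pi(F)=\lim_{n\to\infty}\mathrm{ex}(n,F)/\binom{n}{r}$, and $F$ is nondegenerate if $\pi(F)>0$. $d(n,F) := r\cdot\mathrm{ex}(n,F)/n$ and $\delta(n,F) := \mathrm{ex}(n,F)-\mathrm{ex}(n-1,F)$. For an $r$-graph $\mathcal{H}$, $d(\mathcal{H})$ and $\Delta(\mathcal{H})$ denote the average and maximum vertex degree. A collection $\{\mathcal{H}_1,\dots,\mathcal{H}_{t+1}\}$ of $r$-graphs on a common vertex set $V$ contains a rainbow $F$-matching if there are pairwise disjoint $m$-subsets $S_1,\dots,S_{t+1}$ of $V$ (where $m=v(F)$) such that $\mathcal{H}_i[S_i]$ contains a copy of $F$ for every $i\in[t+1]$. *)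

theory Defs
  imports Complex_Main "HOL-Library.Ramsey" "HOL-Library.Disjoint_Sets"
begin

type_synonym 'a hypergraph = "'a set \<times> 'a set set"

abbreviation verts :: "'a hypergraph \<Rightarrow> 'a set" where
  "verts G \<equiv> fst G"

abbreviation edges :: "'a hypergraph \<Rightarrow> 'a set set" where
  "edges G \<equiv> snd G"

definition rgraph :: "nat \<Rightarrow> 'a hypergraph \<Rightarrow> bool" where
  "rgraph r G \<longleftrightarrow> finite (verts G) \<and> edges G \<subseteq> nsets (verts G) r"

(* Subgraph containment is not required to be induced; isolated vertices of F
   also have to be embedded. *)
definition contains_copy :: "'a hypergraph \<Rightarrow> 'b hypergraph \<Rightarrow> bool" where
  "contains_copy F H \<longleftrightarrow>
     (\<exists>\<phi>. inj_on \<phi> (verts F) \<and> \<phi> ` verts F \<subseteq> verts H \<and> (\<forall>e\<in>edges F. \<phi> ` e \<in> edges H))"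

definition induced :: "'a hypergraph \<Rightarrow> 'a set \<Rightarrow> 'a hypergraph" where
  "induced H S = (S, {e \<in> edges H. e \<subseteq> S})"

(* The uniformity r is an explicit parameter because it cannot be read off an edgeless F.
   The maximum is over a finite set, which is nonempty whenever F has an edge; it is empty
   (and the value unspecified) only for edgeless F with n at least the number of vertices of F.
   Such an F is degenerate in any case. *)
definition ex_num :: "nat \<Rightarrow> nat \<Rightarrow> 'a hypergraph \<Rightarrow> nat" where
  "ex_num r n F = Max {card (edges H) |H :: nat hypergraph.
     rgraph r H \<and> verts H = {..<n} \<and> \<not> contains_copy F H}"

definition turan_density :: "nat \<Rightarrow> 'a hypergraph \<Rightarrow> real" where
  "turan_density r F = lim (\<lambda>n. real (ex_num r n F) / real (n choose r))"

definition nondegenerate :: "nat \<Rightarrow> 'a hypergraph \<Rightarrow> bool" where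
  "nondegenerate r F \<longleftrightarrow> turan_density r F > 0"

definition d_ex :: "nat \<Rightarrow> nat \<Rightarrow> 'a hypergraph \<Rightarrow> real" where
  "d_ex r n F = real r * real (ex_num r n F) / real n"

(* Meant for n > 0 only: n - 1 is truncated subtraction. *)
definition delta_ex :: "nat \<Rightarrow> nat \<Rightarrow> 'a hypergraph \<Rightarrow> real" where
  "delta_ex r n F = real (ex_num r n F) - real (ex_num r (n - 1) F)"

definition degree :: "'a hypergraph \<Rightarrow> 'a \<Rightarrow> nat" where
  "degree H v = card {e \<in> edges H. v \<in> e}"

definition avg_degree :: "'a hypergraph \<Rightarrow> real" where
  "avg_degree H = (\<Sum>v\<in>verts H. real (degree H v)) / real (card (verts H))"

definition max_degree :: "'a hypergraph \<Rightarrow> nat" where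
  "max_degree H = Max (degree H ` verts H)"

(* The members of the collection are the hypergraphs H i for i in I; repetitions are allowed. *)
definition rainbow_matching :: "'a hypergraph \<Rightarrow> 'i set \<Rightarrow> 'v set \<Rightarrow> ('i \<Rightarrow> 'v hypergraph) \<Rightarrow> bool" where
  "rainbow_matching F I V H \<longleftrightarrow>
     (\<exists>S. (\<forall>i\<in>I. S i \<in> nsets V (card (verts F))) \<and> disjoint_family_on S I \<and>
          (\<forall>i\<in>I. contains_copy F (induced (H i) (S i))))"

end

theory Submission
  imports Defs
begin

text \<open>
  Induction on \<open>t\<close> with \<open>n - t\<close> fixed. If some \<open>H i\<close> has a vertex \<open>v\<close> of degree clearly above
  \<open>\<pi>(F) * (n choose (r - 1))\<close>, delete \<open>v\<close> from the other hypergraphs: each loses at most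
  \<open>(n - 1) choose (r - 1)\<close> edges, so the induction hypothesis gives a rainbow matching \<open>W\<close> avoiding \<open>v\<close>.
  The hypergraph \<open>H i - W\<close> still has nearly extremal average degree and a vertex of too large degree, so
  by (a) it contains \<open>F\<close>. If there is no such vertex, a greedy choice works: deleting \<open>m * t\<close> vertices
  costs about \<open>m * t * \<pi>(F) * (n choose (r - 1))\<close> edges, while by (b) the size of \<open>H i\<close> exceeds
  \<open>ex(n - m * t, F)\<close> by about \<open>t * (1 + (m - 1) * \<pi>(F)) * (n choose (r - 1))\<close>.
\<close>

section \<open>Binomial estimates and counts of r-sets\<close>

text \<open>Each of the \<open>k\<close> applications of Pascal's rule loses at most
  \<open>(N - 1) choose (q - 1)\<close>, which is \<open>q / N\<close> times
  \<open>N choose q\<close>. The relative form allows all later errors to be measured against one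
  fixed binomial coefficient.\<close>

lemma binomial_shift_ge:
  assumes "k \<le> N" "0 < N"
  shows "(1 - real k * real q / real N) * real (N choose q) \<le> real ((N - k) choose q)"
proof (cases q)
  case (Suc p)
  have abs: "real q / real N * real (N choose q) = real ((N - 1) choose p)"
    using Suc_times_binomial_eq[of "N - 1" p] assms(2) Suc
    by (simp add: field_simps flip: of_nat_mult)
  have "real (N choose q) \<le> real ((N - k) choose q) + real k * real ((N - 1) choose p)"
    using assms(1)
  proof (induction k)
    case (Suc k)
    have "N - k = Suc (N - Suc k)"
      using Suc.prems by simp
    then have "(N - k) choose q = ((N - Suc k) choose p) + ((N - Suc k) choose q)"
      by (simp add: \<open>q = Suc p\<close>)
    moreover have "(N - Suc k) choose p \<le> (N - 1) choose p"
      by (rule binomial_right_mono) simp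
    ultimately show ?case
      using Suc by (simp add: algebra_simps)
  qed simp
  moreover have "real k * real q / real N * real (N choose q) = real k * real ((N - 1) choose p)"
    using abs by (metis mult.assoc times_divide_eq_right)
  ultimately show ?thesis
    by (simp only: left_diff_distrib mult_1)
qed simp

text \<open>Telescoping Pascal's rule turns the right side into a sum of
  \<open>(n - j) choose (r - 1)\<close> over \<open>j\<close> from 1 to \<open>t\<close>; the last
  summand is the smallest.\<close>

lemma binomial_diff_ge:
  assumes "t \<le> n" "0 < r"
  shows "real t * real ((n - t) choose (r - 1)) \<le> real (n choose r) - real ((n - t) choose r)"
  using assms(1)
proof (induction t)
  case (Suc t)
  have eq: "n - t = Suc (n - Suc t)"
    using Suc.prems by simp
  then have "(n - t) choose r = ((n - Suc t) choose (r - 1)) + ((n - Suc t) choose r)"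
    using assms(2) by (cases r) auto
  moreover have "(n - Suc t) choose (r - 1) \<le> (n - t) choose (r - 1)"
    by (rule binomial_right_mono) simp
  then have "real t * real ((n - Suc t) choose (r - 1)) \<le> real t * real ((n - t) choose (r - 1))"
    by (intro mult_left_mono) auto
  ultimately show ?case
    using Suc by (simp add: algebra_simps)
qed simp

lemma card_nsets: "finite V \<Longrightarrow> card (nsets V r) = card V choose r"
  unfolding nsets_def using n_subsets[of V r] by (simp add: finite_subset conj_commute cong: conj_cong)

lemma card_nsets_superset_le:
  assumes "finite V" "A \<subseteq> V"
  shows "card {e \<in> nsets V r. A \<subseteq> e} \<le> (card V - card A) choose (r - card A)"
proof -
  have "inj_on (\<lambda>e. e - A) {e \<in> nsets V r. A \<subseteq> e}"
    by (rule inj_onI) blast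
  moreover have "(\<lambda>e. e - A) ` {e \<in> nsets V r. A \<subseteq> e} \<subseteq> nsets (V - A) (r - card A)"
    using assms by (auto simp: nsets_def card_Diff_subset finite_subset)
  ultimately have "card {e \<in> nsets V r. A \<subseteq> e} \<le> card (nsets (V - A) (r - card A))"
    using assms by (intro card_inj_on_le) (auto intro: finite_imp_finite_nsets)
  then show ?thesis
    using assms by (simp add: card_nsets card_Diff_subset finite_subset)
qed

section \<open>Uniform hypergraphs, copies and renaming of vertices\<close>

lemma rgraph_finite_edges: "rgraph r H \<Longrightarrow> finite (edges H)"
  unfolding rgraph_def using finite_imp_finite_nsets finite_subset by blast

lemma rgraph_edgeD:
  assumes "rgraph r H" "e \<in> edges H"
  shows "e \<subseteq> verts H" "card e = r" "finite e"
  using assms by (auto simp: rgraph_def nsets_def)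

lemma rgraph_card_edges_le: "rgraph r H \<Longrightarrow> card (edges H) \<le> card (verts H) choose r"
  unfolding rgraph_def using card_mono[OF finite_imp_finite_nsets, of "verts H" "edges H" r]
  by (simp add: card_nsets)

lemma verts_induced [simp]: "verts (induced H X) = X"
  by (simp add: induced_def)

lemma edges_induced [simp]: "edges (induced H X) = {e \<in> edges H. e \<subseteq> X}"
  by (simp add: induced_def)

lemma rgraph_induced:
  assumes "rgraph r H" "X \<subseteq> verts H"
  shows "rgraph r (induced H X)"
  using assms by (auto simp: rgraph_def nsets_def intro: finite_subset)

lemma contains_copy_mono:
  assumes "contains_copy F H" "verts H \<subseteq> verts H'" "edges H \<subseteq> edges H'"
  shows "contains_copy F H'"
proof -
  obtain \<phi> where "inj_on \<phi> (verts F)" "\<phi> ` verts F \<subseteq> verts H" "\<forall>e\<in>edges F. \<phi> ` e \<in> edges H"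
    using assms(1) unfolding contains_copy_def by blast
  then show ?thesis
    unfolding contains_copy_def using assms(2,3) by (intro exI[of _ \<phi>] conjI ballI) blast+
qed

text \<open>Both \<open>ex_num\<close> and the boundedness hypothesis speak of hypergraphs on
  \<open>nat\<close> only. Renaming along an injection carries them over to an arbitrary vertex
  type.\<close>

definition rename :: "('a \<Rightarrow> 'b) \<Rightarrow> 'a hypergraph \<Rightarrow> 'b hypergraph" where
  "rename f H = (f ` verts H, (`) f ` edges H)"

lemma verts_rename [simp]: "verts (rename f H) = f ` verts H"
  by (simp add: rename_def)

lemma edges_rename [simp]: "edges (rename f H) = (`) f ` edges H"
  by (simp add: rename_def)

lemma inj_on_image_edges:
  assumes "rgraph r H" "inj_on f (verts H)"
  shows "inj_on ((`) f) (edges H)"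
  using inj_on_image_eq_iff[OF assms(2)] rgraph_edgeD(1)[OF assms(1)] by (simp add: inj_on_def)

lemma rgraph_rename:
  assumes "rgraph r H" "inj_on f (verts H)"
  shows "rgraph r (rename f H)"
  using assms by (auto simp: rgraph_def nsets_def card_image inj_on_subset)

lemma card_edges_rename:
  assumes "rgraph r H" "inj_on f (verts H)"
  shows "card (edges (rename f H)) = card (edges H)"
  using inj_on_image_edges[OF assms] by (simp add: card_image)

lemma degree_rename:
  assumes H: "rgraph r H" and f: "inj_on f (verts H)" and v: "v \<in> verts H"
  shows "degree (rename f H) (f v) = degree H v"
proof -
  have "{e \<in> edges (rename f H). f v \<in> e} = (`) f ` {e \<in> edges H. f v \<in> f ` e}"
    by (simp only: edges_rename) blast
  also have "{e \<in> edges H. f v \<in> f ` e} = {e \<in> edges H. v \<in> e}"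
    using inj_on_image_mem_iff[OF f v] rgraph_edgeD(1)[OF H] by (intro Collect_cong) blast
  finally have "{e \<in> edges (rename f H). f v \<in> e} = (`) f ` {e \<in> edges H. v \<in> e}" .
  then show ?thesis
    unfolding degree_def
    by (metis (no_types, lifting) card_image inj_on_image_edges[OF H f] inj_on_subset mem_Collect_eq subsetI)
qed

lemma contains_copy_rename:
  assumes F: "rgraph s F" and H: "rgraph r H" and f: "inj_on f (verts H)"
    and copy: "contains_copy F (rename f H)"
  shows "contains_copy F H"
proof -
  obtain \<phi> where \<phi>: "inj_on \<phi> (verts F)" "\<phi> ` verts F \<subseteq> f ` verts H"
      "\<And>e. e \<in> edges F \<Longrightarrow> \<phi> ` e \<in> (`) f ` edges H"
    using copy unfolding contains_copy_def by auto
  define g where "g = inv_into (verts H) f"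
  have gf: "g ` f ` X = X" if "X \<subseteq> verts H" for X
    using that f by (simp add: g_def inv_into_image_cancel)
  have "inj_on (g \<circ> \<phi>) (verts F)"
    using \<phi>(1,2) by (metis comp_inj_on inj_on_inv_into g_def)
  moreover have "(g \<circ> \<phi>) ` verts F \<subseteq> verts H"
    using \<phi>(2) by (auto simp: g_def intro!: inv_into_into)
  moreover have "(g \<circ> \<phi>) ` e \<in> edges H" if "e \<in> edges F" for e
  proof -
    have "\<phi> ` e \<in> (`) f ` edges H"
      by (rule \<phi>(3)) fact
    then obtain e' where "e' \<in> edges H" "\<phi> ` e = f ` e'"
      by auto
    then show ?thesis
      using gf[of e'] rgraph_edgeD(1)[OF H] by (metis image_comp)
  qed
  ultimately show ?thesis
    unfolding contains_copy_def by blast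
qed

section \<open>Degrees and vertex deletion\<close>

lemma handshake:
  assumes "rgraph r H"
  shows "(\<Sum>v\<in>verts H. degree H v) = r * card (edges H)"
  unfolding degree_def
proof (rule sum_multicount)
  show "\<forall>e\<in>edges H. card {v \<in> verts H. v \<in> e} = r"
  proof
    fix e assume e: "e \<in> edges H"
    then have "{v \<in> verts H. v \<in> e} = e"
      using rgraph_edgeD(1)[OF assms] by auto
    then show "card {v \<in> verts H. v \<in> e} = r"
      using rgraph_edgeD(2)[OF assms e] by simp
  qed
qed (use assms rgraph_finite_edges[OF assms] in \<open>auto simp: rgraph_def\<close>)

lemma avg_degree_eq:
  assumes "rgraph r H"
  shows "avg_degree H = real r * real (card (edges H)) / real (card (verts H))"
  unfolding avg_degree_def by (simp add: handshake[OF assms] flip: of_nat_sum)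

lemma degree_le:
  assumes "rgraph r H" "v \<in> verts H"
  shows "degree H v \<le> (card (verts H) - 1) choose (r - 1)"
proof -
  have "degree H v \<le> card {e \<in> nsets (verts H) r. {v} \<subseteq> e}"
    unfolding degree_def using assms(1)
    by (intro card_mono) (auto simp: rgraph_def intro: finite_subset[OF _ finite_imp_finite_nsets])
  also have "\<dots> \<le> (card (verts H) - 1) choose (r - 1)"
    using card_nsets_superset_le[of "verts H" "{v}" r] assms by (simp add: rgraph_def)
  finally show ?thesis .
qed

lemma card_edges_delete_le:
  assumes "rgraph r H" "W \<subseteq> verts H"
  shows "card (edges H) \<le> card (edges (induced H (verts H - W))) + (\<Sum>w\<in>W. degree H w)"
proof -
  have fin: "finite W" "finite (edges H)"
    using assms rgraph_finite_edges[OF assms(1)] by (auto simp: rgraph_def intro: finite_subset)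
  have "edges H \<subseteq> edges (induced H (verts H - W)) \<union> (\<Union>w\<in>W. {e \<in> edges H. w \<in> e})"
    using rgraph_edgeD(1)[OF assms(1)] by auto
  then have "card (edges H) \<le> card (edges (induced H (verts H - W)) \<union> (\<Union>w\<in>W. {e \<in> edges H. w \<in> e}))"
    using fin by (intro card_mono) auto
  also have "\<dots> \<le> card (edges (induced H (verts H - W))) + card (\<Union>w\<in>W. {e \<in> edges H. w \<in> e})"
    by (rule card_Un_le)
  also have "card (\<Union>w\<in>W. {e \<in> edges H. w \<in> e}) \<le> (\<Sum>w\<in>W. degree H w)"
    unfolding degree_def using fin by (intro card_UN_le)
  finally show ?thesis
    by simp
qed

text \<open>An edge at \<open>v\<close> that disappears contains \<open>v\<close> together with some
  \<open>w\<close> in \<open>W\<close>, so a union bound over the codegrees of such pairs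
  suffices.\<close>

lemma degree_delete_le:
  assumes H: "rgraph r H" and W: "W \<subseteq> verts H - {v}" and v: "v \<in> verts H" and r: "2 \<le> r"
  shows "degree H v \<le> degree (induced H (verts H - W)) v
           + card W * ((card (verts H) - 1) choose (r - 2))"
proof -
  have finV: "finite (verts H)"
    using H by (simp add: rgraph_def)
  have fin: "finite W" "finite (edges H)"
    using finV W rgraph_finite_edges[OF H] by (auto intro: finite_subset)
  have pair: "card {e \<in> edges H. v \<in> e \<and> w \<in> e} \<le> (card (verts H) - 1) choose (r - 2)"
    if "w \<in> W" for w
  proof -
    have "w \<noteq> v" "{v, w} \<subseteq> verts H"
      using that W v by auto
    have "card {e \<in> edges H. v \<in> e \<and> w \<in> e} \<le> card {e \<in> nsets (verts H) r. {v, w} \<subseteq> e}"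
      using H by (intro card_mono) (auto simp: rgraph_def intro: finite_subset[OF _ finite_imp_finite_nsets])
    also have "\<dots> \<le> (card (verts H) - 2) choose (r - 2)"
      using card_nsets_superset_le[OF finV \<open>{v, w} \<subseteq> verts H\<close>, of r] \<open>w \<noteq> v\<close> by (simp add: numeral_2_eq_2)
    \<comment> \<open>This weakening gives the form that the absorption identity relates directly to
      \<open>card (verts H) choose (r - 1)\<close>.\<close>
    also have "\<dots> \<le> (card (verts H) - 1) choose (r - 2)"
      by (rule binomial_right_mono) simp
    finally show ?thesis .
  qed
  have "{e \<in> edges H. v \<in> e} \<subseteq> {e \<in> edges (induced H (verts H - W)). v \<in> e}
          \<union> (\<Union>w\<in>W. {e \<in> edges H. v \<in> e \<and> w \<in> e})"
    using rgraph_edgeD(1)[OF H] by auto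
  then have "degree H v \<le> card ({e \<in> edges (induced H (verts H - W)). v \<in> e}
          \<union> (\<Union>w\<in>W. {e \<in> edges H. v \<in> e \<and> w \<in> e}))"
    unfolding degree_def using fin by (intro card_mono) auto
  also have "\<dots> \<le> degree (induced H (verts H - W)) v
          + card (\<Union>w\<in>W. {e \<in> edges H. v \<in> e \<and> w \<in> e})"
    unfolding degree_def by (rule card_Un_le)
  also have "card (\<Union>w\<in>W. {e \<in> edges H. v \<in> e \<and> w \<in> e})
          \<le> (\<Sum>w\<in>W. card {e \<in> edges H. v \<in> e \<and> w \<in> e})"
    using fin by (intro card_UN_le)
  also have "\<dots> \<le> card W * ((card (verts H) - 1) choose (r - 2))"
    using sum_bounded_above[of W "\<lambda>w. card {e \<in> edges H. v \<in> e \<and> w \<in> e}"] pair by simp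
  finally show ?thesis
    by simp
qed

section \<open>Turan numbers and Turan density\<close>

lemma ex_num_finite:
  "finite {card (edges H) |H :: nat hypergraph.
     rgraph r H \<and> verts H = {..<n} \<and> \<not> contains_copy F H}"
proof (rule finite_subset)
  show "{card (edges H) |H :: nat hypergraph.
     rgraph r H \<and> verts H = {..<n} \<and> \<not> contains_copy F H} \<subseteq> {..n choose r}"
    using rgraph_card_edges_le by fastforce
qed simp

lemma card_edges_le_ex_num:
  assumes F: "rgraph s F" and H: "rgraph r H" and free: "\<not> contains_copy F H"
  shows "card (edges H) \<le> ex_num r (card (verts H)) F"
proof -
  obtain f where f: "bij_betw f (verts H) {..<card (verts H)}"
    using H by (metis rgraph_def bij_betw_iff_card card_lessThan finite_lessThan)
  then have inj: "inj_on f (verts H)" and "f ` verts H = {..<card (verts H)}"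
    by (auto simp: bij_betw_def)
  then have "card (edges (rename f H)) \<le> ex_num r (card (verts H)) F"
    unfolding ex_num_def using rgraph_rename[OF H inj] contains_copy_rename[OF F H inj] free
    by (intro Max_ge ex_num_finite CollectI exI[of _ "rename f H"]) auto
  then show ?thesis
    by (simp only: card_edges_rename[OF H inj])
qed

lemma ex_num_attained:
  assumes "edges F \<noteq> {}"
  obtains H :: "nat hypergraph" where "rgraph r H" "verts H = {..<n}" "\<not> contains_copy F H"
    "card (edges H) = ex_num r n F"
proof -
  let ?X = "{card (edges H) |H :: nat hypergraph.
     rgraph r H \<and> verts H = {..<n} \<and> \<not> contains_copy F H}"
  have "rgraph r ({..<n}, {})" "\<not> contains_copy F ({..<n}, {})"
    using assms by (auto simp: rgraph_def contains_copy_def)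
  then have "?X \<noteq> {}"
    by fastforce
  then have "ex_num r n F \<in> ?X"
    unfolding ex_num_def using Max_in[OF ex_num_finite] by blast
  then show thesis
    using that by auto
qed

text \<open>Averaging over vertex deletions: removing any vertex from an extremal hypergraph on
  \<open>Suc n\<close> vertices leaves an \<open>F\<close>-free one on \<open>n\<close> vertices,
  and the deleted degrees sum to \<open>r\<close> times the number of edges.\<close>

lemma ex_num_averaging:
  assumes F: "rgraph s F" and "edges F \<noteq> {}"
  shows "(Suc n - r) * ex_num r (Suc n) F \<le> Suc n * ex_num r n F"
proof -
  obtain H :: "nat hypergraph" where H: "rgraph r H" "verts H = {..<Suc n}" "\<not> contains_copy F H"
    and card: "card (edges H) = ex_num r (Suc n) F"
    using ex_num_attained[OF assms(2)] by metis
  have del: "card (edges H) \<le> ex_num r n F + degree H v" if "v \<in> verts H" for v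
  proof -
    let ?H' = "induced H (verts H - {v})"
    have "\<not> contains_copy F ?H'"
      using H(3) contains_copy_mono[of F ?H' H] by auto
    moreover have "card (verts ?H') = n"
      using H(2) that by simp
    ultimately have "card (edges ?H') \<le> ex_num r n F"
      using card_edges_le_ex_num[OF F rgraph_induced[OF H(1)], of "verts H - {v}"] by auto
    then show ?thesis
      using card_edges_delete_le[OF H(1), of "{v}"] that by simp
  qed
  have "Suc n * card (edges H) = (\<Sum>v\<in>verts H. card (edges H))"
    using H(2) by simp
  also have "\<dots> \<le> (\<Sum>v\<in>verts H. ex_num r n F + degree H v)"
    by (rule sum_mono) (rule del)
  also have "\<dots> = Suc n * ex_num r n F + r * card (edges H)"
    using handshake[OF H(1)] H(2) by (simp add: sum.distrib)
  finally show ?thesis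
    using card by (simp add: diff_mult_distrib)
qed

text \<open>Since \<open>lim\<close> denotes something even for a divergent sequence, convergence
  has to be proved. By averaging, the ratios are nonincreasing, and they are bounded below by
  0.\<close>

lemma turan_density_limit:
  assumes "rgraph s F" "edges F \<noteq> {}"
  shows "(\<lambda>n. real (ex_num r n F) / real (n choose r)) \<longlonglongrightarrow> turan_density r F"
proof -
  let ?X = "\<lambda>n. real (ex_num r n F) / real (n choose r)"
  have "?X (Suc n) \<le> ?X n" if "r \<le> n" for n
  proof -
    have "real (Suc n - r) * real (Suc n choose r) = real (Suc n) * real (n choose r)"
      using binomial_absorb_comp[of "Suc n" r] by (simp only: diff_Suc_1 flip: of_nat_mult)
    moreover have "real (Suc n - r) * real (ex_num r (Suc n) F) \<le> real (Suc n) * real (ex_num r n F)"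
      using ex_num_averaging[OF assms, of n r] by (simp only: of_nat_le_iff flip: of_nat_mult)
    moreover have "real (Suc n - r) > 0" "real (n choose r) > 0" "real (Suc n) > 0"
      using that by auto
    ultimately show ?thesis
      by (metis mult_divide_mult_cancel_left less_irrefl divide_right_mono mult_pos_pos less_imp_le)
  qed
  \<comment> \<open>The shift by \<open>r\<close> skips the indices where \<open>n choose r\<close>
    is 0 and the quotient takes the default value 0; monotonicity can fail there.\<close>
  then have "decseq (\<lambda>n. ?X (n + r))"
    by (intro decseq_SucI) simp
  then have "convergent (\<lambda>n. ?X (n + r))"
    by (rule decseq_convergent[where B = 0]) (auto intro: convergentI)
  then have "convergent ?X"
    by (simp only: convergent_ignore_initial_segment[of ?X r])
  then show ?thesis
    by (simp add: turan_density_def convergent_LIMSEQ_iff)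
qed

text \<open>Once there are enough vertices, every hypergraph contains an edgeless \<open>F\<close>.
  Then \<open>ex_num\<close> is the fixed number \<open>Max {}\<close>, whatever its value, and
  dividing it by \<open>n choose r\<close> gives the limit 0.\<close>

lemma nondegenerate_imp_edges:
  assumes F: "rgraph s F" and r: "0 < r" and nondeg: "nondegenerate r F"
  shows "edges F \<noteq> {}"
proof
  assume empty: "edges F = {}"
  have "contains_copy F H" if "verts H = {..<n}" "card (verts F) \<le> n" for H :: "nat hypergraph" and n
    using card_le_inj[of "verts F" "verts H"] F that empty
    by (auto simp: contains_copy_def rgraph_def)
  then have ex: "ex_num r n F = Max {}" if "card (verts F) \<le> n" for n
    unfolding ex_num_def using that by (intro arg_cong[of _ _ Max]) auto
  let ?X = "\<lambda>n. real (ex_num r n F) / real (n choose r)"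
  have "?X \<longlonglongrightarrow> 0"
  proof (rule tendsto_sandwich[of "\<lambda>_. 0"])
    show "\<forall>\<^sub>F n in sequentially. ?X n \<le> real (Max {}) * real r / real n"
      using eventually_ge_at_top[of "max 1 (max r (card (verts F)))"]
    proof eventually_elim
      case (elim n)
      have "real n / real r \<le> (real n / real r) ^ r"
        using elim r by (intro self_le_power) auto
      also have "\<dots> \<le> real (n choose r)"
        using elim by (intro binomial_ge_n_over_k_pow_k) auto
      finally have "real n / real r \<le> real (n choose r)" .
      moreover have "0 < real n / real r"
        using elim r by simp
      ultimately have "real (Max {}) / real (n choose r) \<le> real (Max {}) / (real n / real r)"
        using elim by (intro divide_left_mono mult_pos_pos) auto
      then show ?case
        using ex elim by simp
    qed
    show "(\<lambda>n. real (Max {}) * real r / real n) \<longlonglongrightarrow> 0"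
      by (rule lim_const_over_n)
  qed auto
  then have "turan_density r F = 0"
    unfolding turan_density_def by (rule limI)
  then show False
    using nondeg by (simp add: nondegenerate_def)
qed

section \<open>Extending rainbow matchings\<close>

text \<open>A rainbow matching asks for sets of size exactly \<open>card (verts F)\<close>; the
  image of the embedding is such a set.\<close>

lemma contains_copy_induced_support:
  assumes F: "rgraph s F" and copy: "contains_copy F (induced H X)"
  obtains S where "S \<in> nsets X (card (verts F))" "contains_copy F (induced H S)"
proof -
  obtain \<phi> where \<phi>: "inj_on \<phi> (verts F)" "\<phi> ` verts F \<subseteq> X" "\<And>e. e \<in> edges F \<Longrightarrow> \<phi> ` e \<in> edges H"
    using copy by (auto simp: contains_copy_def)
  show thesis
  proof
    show "\<phi> ` verts F \<in> nsets X (card (verts F))"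
      using \<phi>(1,2) F by (simp add: nsets_def card_image rgraph_def)
    have "\<phi> ` e \<subseteq> \<phi> ` verts F" if "e \<in> edges F" for e
      using rgraph_edgeD(1)[OF F that] by (rule image_mono)
    then show "contains_copy F (induced H (\<phi> ` verts F))"
      unfolding contains_copy_def using \<phi>(1,3) by (intro exI[of _ \<phi>]) auto
  qed
qed

text \<open>The old matching is confined to \<open>X\<close>, while the new copy may use all of
  \<open>V\<close>. The greedy argument takes \<open>X = V\<close>; the inductive one takes
  \<open>V\<close> without a high-degree vertex, which stays available for the copy in
  \<open>H i\<close>.\<close>

lemma rainbow_matching_insert:
  assumes F: "rgraph s F" and J: "finite J" "i \<notin> J"
    and matching: "rainbow_matching F J X H" and "X \<subseteq> V"
    and copy: "\<And>U. U \<subseteq> X \<Longrightarrow> card U = card (verts F) * card J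
                 \<Longrightarrow> contains_copy F (induced (H i) (V - U))"
  shows "rainbow_matching F (insert i J) V H"
proof -
  obtain S where S: "\<And>j. j \<in> J \<Longrightarrow> S j \<in> nsets X (card (verts F))" "disjoint_family_on S J"
      "\<And>j. j \<in> J \<Longrightarrow> contains_copy F (induced (H j) (S j))"
    using matching unfolding rainbow_matching_def by auto
  have "card (\<Union>j\<in>J. S j) = (\<Sum>j\<in>J. card (S j))"
    using S(1,2) J(1) by (intro card_UN_disjoint) (auto simp: nsets_def disjoint_family_on_def)
  also have "\<dots> = card (verts F) * card J"
    using S(1) by (simp add: nsets_def)
  finally have "contains_copy F (induced (H i) (V - (\<Union>j\<in>J. S j)))"
    using S(1) by (intro copy) (auto simp: nsets_def)
  then obtain T where T: "T \<in> nsets (V - (\<Union>j\<in>J. S j)) (card (verts F))"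
      "contains_copy F (induced (H i) T)"
    by (rule contains_copy_induced_support[OF F])
  have "disjoint_family_on (S(i := T)) (insert i J)"
    using S(2) T(1) J(2) by (auto simp: disjoint_family_on_def nsets_def)
  moreover have "(S(i := T)) j \<in> nsets V (card (verts F))" if "j \<in> insert i J" for j
    using S(1)[of j] T(1) that \<open>X \<subseteq> V\<close> by (cases "j = i") (auto simp: nsets_def)
  ultimately show ?thesis
    unfolding rainbow_matching_def using S(3) T(2) by (intro exI[of _ "S(i := T)"]) auto
qed

text \<open>Copies are chosen one after another. It is enough to test sets \<open>W\<close> of the
  largest size that can be occupied: a smaller occupied set is enlarged to such a \<open>W\<close>,
  and a copy avoiding \<open>W\<close> avoids it too.\<close>

lemma rainbow_matching_greedy:
  assumes F: "rgraph s F" and I: "finite I" and V: "finite V" "card (verts F) * (card I - 1) \<le> card V"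
    and copy: "\<And>i W. i \<in> I \<Longrightarrow> W \<subseteq> V \<Longrightarrow> card W = card (verts F) * (card I - 1)
                 \<Longrightarrow> contains_copy F (induced (H i) (V - W))"
  shows "rainbow_matching F I V H"
  using I subset_refl[of I]
proof (induction rule: finite_subset_induct')
  case empty
  then show ?case
    by (simp add: rainbow_matching_def disjoint_family_on_def)
next
  case (insert i J)
  show ?case
  proof (rule rainbow_matching_insert[OF F insert.hyps(1) _ insert.IH subset_refl])
    fix U assume U: "U \<subseteq> V" "card U = card (verts F) * card J"
    have "J \<subset> I"
      using insert.hyps by blast
    then have "card J \<le> card I - 1"
      using psubset_card_mono[OF I, of J] by linarith
    then have "card U \<le> card (verts F) * (card I - 1)"
      using U(2) by simp
    then obtain W where W: "U \<subseteq> W" "W \<subseteq> V" "card W = card (verts F) * (card I - 1)"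
      using exists_subset_between[OF _ V(2) U(1) V(1)] by blast
    show "contains_copy F (induced (H i) (V - U))"
      by (rule contains_copy_mono[OF copy[OF insert.hyps(2) W(2,3)]]) (use W(1) in auto)
  qed (use insert in auto)
qed

lemma rainbow_matching_induced:
  assumes "rainbow_matching F I V (\<lambda>i. induced (H i) X)"
  shows "rainbow_matching F I V H"
proof -
  have "contains_copy F (induced (H i) S)" if "contains_copy F (induced (induced (H i) X) S)" for i S
    by (rule contains_copy_mono[OF that]) auto
  then show ?thesis
    using assms unfolding rainbow_matching_def by blast
qed

section \<open>Standing assumptions and their immediate consequences\<close>

text \<open>Here \<open>p\<close> is the Turan density, and all error terms are integer multiples of \<open>u\<close>.\<close>
locale turan_regime =
  fixes F :: "'a hypergraph" and r m N :: nat and c p u :: real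
  assumes r_le_m: "r \<le> m" and r_ge_2: "2 \<le> r"
    and rgraph_F: "rgraph r F" and card_F: "card (verts F) = m"
    and c_pos: "0 < c" and p_pos: "0 < p" and u_pos: "0 < u" and u_eq: "64 * real m * u = 1 - p"
    and bounded: "\<And>n H. N \<le> n \<Longrightarrow> rgraph r (H :: nat hypergraph) \<Longrightarrow> card (verts H) = n \<Longrightarrow>
        \<not> contains_copy F H \<Longrightarrow> d_ex r n F - c * real (n choose (r - 1)) \<le> avg_degree H \<Longrightarrow>
        real (max_degree H) \<le> d_ex r n F + 16 * u * real (n choose (r - 1))"
    and smooth: "\<And>n. N \<le> n \<Longrightarrow>
        \<bar>delta_ex r n F - d_ex r (n - 1) F\<bar> \<le> 8 * u * real (n choose (r - 1))"
    and density: "\<And>n. N \<le> n \<Longrightarrow>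
        \<bar>real (ex_num r n F) - p * real (n choose r)\<bar> \<le> u * real (n choose r)"
    and large: "\<And>n. N \<le> n \<Longrightarrow> real r \<le> u * real n"
begin

lemma u_small: "128 * u \<le> 1" and p_less_1: "p < 1"
proof -
  have "2 * u \<le> real m * u"
    using r_le_m r_ge_2 u_pos by (intro mult_right_mono) auto
  then show "128 * u \<le> 1" "p < 1"
    using u_eq p_pos u_pos by linarith+
qed

lemma N_le_imp_pos: "N \<le> n \<Longrightarrow> 0 < n"
proof -
  assume "N \<le> n"
  then have "0 < u * real n"
    using large[of n] r_ge_2 by linarith
  then show "0 < n"
    by (rule contrapos_pp) simp
qed

text \<open>This is \<open>bounded\<close> for any vertex type: renaming into \<open>nat\<close>
  preserves average degree, vertex degrees and \<open>F\<close>-freeness.\<close>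

lemma degree_bounded:
  assumes "rgraph r (H :: 'v hypergraph)" "N \<le> card (verts H)" "\<not> contains_copy F H"
    and "d_ex r (card (verts H)) F - c * real (card (verts H) choose (r - 1)) \<le> avg_degree H"
    and v: "v \<in> verts H"
  shows "real (degree H v) \<le> d_ex r (card (verts H)) F + 16 * u * real (card (verts H) choose (r - 1))"
proof -
  have "finite (verts H)"
    using assms(1) by (simp add: rgraph_def)
  then obtain f :: "'v \<Rightarrow> nat" where inj: "inj_on f (verts H)"
    using finite_imp_inj_to_nat_seg by metis
  have card: "card (verts (rename f H)) = card (verts H)"
    using inj by (simp add: card_image)
  have rename: "rgraph r (rename f H)"
    by (rule rgraph_rename[OF assms(1) inj])
  have "avg_degree (rename f H) = avg_degree H"
    using avg_degree_eq[OF rename] avg_degree_eq[OF assms(1)] card card_edges_rename[OF assms(1) inj]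
    by simp
  then have "real (max_degree (rename f H))
      \<le> d_ex r (card (verts H)) F + 16 * u * real (card (verts H) choose (r - 1))"
    using assms contains_copy_rename[OF rgraph_F assms(1) inj] rename card by (intro bounded) auto
  moreover have "degree H v \<le> max_degree (rename f H)"
    unfolding max_degree_def using v \<open>finite (verts H)\<close> degree_rename[OF assms(1) inj v]
    by (intro Max_ge) (auto intro!: image_eqI[of _ _ "f v"])
  ultimately show ?thesis
    by linarith
qed

text \<open>Scaling \<open>density\<close> by \<open>r / n\<close> proves this, because
  \<open>(n - 1) choose (r - 1)\<close> equals \<open>r / n\<close> times
  \<open>n choose r\<close>.\<close>

lemma d_ex_approx:
  assumes "N \<le> n"
  shows "\<bar>d_ex r n F - p * real ((n - 1) choose (r - 1))\<bar> \<le> u * real ((n - 1) choose (r - 1))"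
proof -
  have n: "0 < real n"
    using N_le_imp_pos[OF assms] by simp
  have "real r * real (n choose r) = real n * real ((n - 1) choose (r - 1))"
    using times_binomial_minus1_eq[of r n] r_ge_2 by (simp flip: of_nat_mult)
  then have C: "real ((n - 1) choose (r - 1)) = real r / real n * real (n choose r)"
    using n by (simp add: field_simps)
  have "\<bar>d_ex r n F - p * real ((n - 1) choose (r - 1))\<bar>
      = real r / real n * \<bar>real (ex_num r n F) - p * real (n choose r)\<bar>"
    using n unfolding d_ex_def C
    by (subst abs_mult_pos') (simp_all add: right_diff_distrib mult.left_commute)
  also have "\<dots> \<le> real r / real n * (u * real (n choose r))"
    using density[OF assms] n by (intro mult_left_mono) auto
  finally show ?thesis
    unfolding C by (simp add: mult.left_commute)
qed

section \<open>Admissible parameters and estimates between n - m * t and n\<close>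

text \<open>Since \<open>2 * m * t \<le> n\<close>, the condition \<open>2 * N \<le> n - t\<close> yields \<open>N \<le> n - m * t\<close>; it is phrased through
  \<open>n - t\<close> because that difference is invariant along the induction.\<close>
definition admissible :: "nat \<Rightarrow> nat \<Rightarrow> bool" where
  "admissible n t \<longleftrightarrow> t \<le> n \<and> 2 * N \<le> n - t
     \<and> real r * real m * real t \<le> u * real n \<and> 4 * real r * real m * real t \<le> c * real n"

text \<open>In the bound with \<open>u\<close>, the left side drops by \<open>r * m\<close>, which
  is at least 1, and the right side only by \<open>u\<close>, which is less than 1.\<close>

lemma admissible_Suc:
  assumes "admissible (Suc n) (Suc t)"
  shows "admissible n t"
proof -
  have "1 * 1 \<le> real r * real m"
    using r_le_m r_ge_2 by (intro mult_mono) auto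
  then have m: "1 \<le> real r * real m"
    by simp
  have t: "t \<le> n"
    using assms by (simp add: admissible_def)
  have "real r * real m * real t + real r * real m \<le> u * real n + u"
    using assms by (simp add: admissible_def algebra_simps)
  then have "real r * real m * real t \<le> u * real n"
    using m u_small u_pos by linarith
  moreover have "4 * real r * real m * real t \<le> c * real n"
  \<comment> \<open>If \<open>c\<close> is at most \<open>4 * r * m\<close>, the left side again
    drops by at least as much as the right. Otherwise \<open>t \<le> n\<close> gives the bound
    outright.\<close>
  proof (cases "c \<le> 4 * real r * real m")
    case True
    have "4 * real r * real m * real t + 4 * real r * real m \<le> c * real n + c"
      using assms by (simp add: admissible_def algebra_simps)
    then show ?thesis
      using True by linarith
  next
    case False
    then show ?thesis
      using t c_pos by (intro mult_mono) auto
  qed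
  ultimately show ?thesis
    using assms t by (simp add: admissible_def)
qed

context
  fixes n t :: nat
  assumes adm: "admissible n t"
begin

lemma mt_le: "real (m * t) \<le> u * real n" "2 * (m * t) \<le> n"
proof -
  have "real (m * t) \<le> real r * real (m * t)"
    using r_ge_2 mult_right_mono[of 1 "real r" "real (m * t)"] by simp
  also have "\<dots> \<le> u * real n"
    using adm by (simp add: admissible_def mult.assoc)
  finally show mt: "real (m * t) \<le> u * real n" .
  have "u * real n \<le> 1 / 2 * real n"
    using u_small u_pos by (intro mult_right_mono) auto
  then show "2 * (m * t) \<le> n"
    using mt by linarith
qed

lemma N_le:
  assumes "n - m * t \<le> k"
  shows "N \<le> k"
proof -
  have "2 * N + t \<le> n"
    using adm by (auto simp: admissible_def)
  then show ?thesis
    using mt_le(2) assms by linarith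
qed

lemma n_pos: "0 < n"
  using N_le[of n] N_le_imp_pos by simp

text \<open>The shift from \<open>n\<close> to \<open>k - 1\<close> is at most
  \<open>m * t + 1\<close>. Its relative cost is at most \<open>u\<close> for \<open>m * t\<close>,
  by admissibility, plus \<open>u\<close> for the extra 1, by \<open>large\<close>.\<close>

lemma binomial_window:
  assumes "n - m * t \<le> k" "k \<le> n"
  shows "(1 - 2 * u) * real (n choose (r - 1)) \<le> real ((k - 1) choose (r - 1))"
proof -
  define j where "j = n - (k - 1)"
  have k: "0 < k"
    using N_le[OF assms(1)] by (rule N_le_imp_pos)
  have j: "j \<le> m * t + 1" "k - 1 = n - j" "j \<le> n"
    using assms k mt_le(2) by (auto simp: j_def)
  have "real j * real (r - 1) \<le> real (m * t + 1) * real r"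
    using j(1) by (intro mult_mono; linarith)
  also have "\<dots> \<le> u * real n + u * real n"
    using adm large[OF N_le[of n]] by (simp add: admissible_def algebra_simps)
  finally have "real j * real (r - 1) / real n \<le> 2 * u"
    using n_pos by (simp add: field_simps)
  then have "(1 - 2 * u) * real (n choose (r - 1))
      \<le> (1 - real j * real (r - 1) / real n) * real (n choose (r - 1))"
    by (intro mult_right_mono) auto
  also have "\<dots> \<le> real ((n - j) choose (r - 1))"
    using j(3) n_pos by (rule binomial_shift_ge)
  finally show ?thesis
    by (simp only: j(2))
qed

lemma binomial_window':
  assumes "n - m * t \<le> k" "k \<le> n"
  shows "(1 - 2 * u) * real (n choose (r - 1)) \<le> real (k choose (r - 1))"
    and "real ((k - 1) choose (r - 1)) \<le> real (n choose (r - 1))"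
    and "real (k choose (r - 1)) \<le> real (n choose (r - 1))"
  using binomial_window[OF assms] binomial_right_mono[of "k - 1" k "r - 1"]
    binomial_right_mono[of k n "r - 1"] assms(2) by linarith+

text \<open>In the lower bound one \<open>u\<close> comes from \<open>d_ex_approx\<close>, and two
  come from replacing the binomial coefficient, where \<open>p < 1\<close> is used to bound
  \<open>p * u\<close> by \<open>u\<close>.\<close>

lemma d_ex_window:
  assumes "n - m * t \<le> k" "k \<le> n"
  shows "(p - 3 * u) * real (n choose (r - 1)) \<le> d_ex r k F"
    and "d_ex r k F \<le> (p + u) * real (n choose (r - 1))"
proof -
  let ?D = "real (n choose (r - 1))" and ?C = "real ((k - 1) choose (r - 1))"
  have approx: "\<bar>d_ex r k F - p * ?C\<bar> \<le> u * ?C"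
    by (rule d_ex_approx[OF N_le[OF assms(1)]])
  have uC: "u * ?C \<le> u * ?D" and pC: "p * ?C \<le> p * ?D"
    using binomial_window'(2)[OF assms] u_pos p_pos by (simp_all add: mult_left_mono)
  show "d_ex r k F \<le> (p + u) * ?D"
    using approx uC pC unfolding distrib_right abs_le_iff by linarith
  have "p * ((1 - 2 * u) * ?D) \<le> p * ?C"
    using binomial_window[OF assms] p_pos by (intro mult_left_mono) auto
  moreover have "p * (u * ?D) \<le> 1 * (u * ?D)"
    using p_less_1 u_pos by (intro mult_right_mono) auto
  moreover have "(p - 3 * u) * ?D = p * ((1 - 2 * u) * ?D) + 2 * (p * (u * ?D)) - 3 * (u * ?D)"
    by (simp add: algebra_simps)
  ultimately show "(p - 3 * u) * ?D \<le> d_ex r k F"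
    using approx uC unfolding abs_le_iff by linarith
qed

text \<open>The increments telescope. By \<open>smooth\<close> each is at least the preceding
  \<open>d_ex\<close> value minus \<open>8 * u\<close> units, and \<open>d_ex_window\<close> costs
  another \<open>3 * u\<close>, whence \<open>11 * u\<close>.\<close>

lemma ex_num_window:
  assumes "a \<le> b" "n - m * t \<le> a" "b \<le> n"
  shows "real (b - a) * ((p - 11 * u) * real (n choose (r - 1)))
           \<le> real (ex_num r b F) - real (ex_num r a F)"
  using assms(1,3)
proof (induction b rule: dec_induct)
  case (step k)
  have k: "n - m * t \<le> k" "k \<le> n" "n - m * t \<le> Suc k"
    using step assms(2) by auto
  have "\<bar>delta_ex r (Suc k) F - d_ex r k F\<bar> \<le> 8 * u * real (Suc k choose (r - 1))"
    using smooth[OF N_le[OF k(3)]] by simp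
  also have "\<dots> \<le> 8 * u * real (n choose (r - 1))"
    using binomial_window'(3)[OF k(3)] step.prems u_pos by (intro mult_left_mono) auto
  finally have "(p - 11 * u) * real (n choose (r - 1))
      \<le> real (ex_num r (Suc k) F) - real (ex_num r k F)"
    using d_ex_window(1)[OF k(1,2)] by (simp add: delta_ex_def left_diff_distrib abs_le_iff)
  then show ?case
    using step by (simp add: Suc_diff_le algebra_simps)
qed simp

text \<open>This compares the assumed edge count with the Turan number after deleting
  \<open>m * t\<close> vertices. The binomial difference contributes \<open>t\<close> terms of
  weight \<open>1 - 2 * u\<close>, and the Turan numbers contribute \<open>(m - 1) * t\<close>
  increments of weight \<open>p - 11 * u\<close>.\<close>

lemma size_gap:
  "real (m * t) * ((p + 53 * u) * real (n choose (r - 1)))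
     \<le> real (n choose r) - real ((n - t) choose r)
       + real (ex_num r (n - t) F) - real (ex_num r (n - m * t) F)"
proof -
  let ?D = "real (n choose (r - 1))"
  have t: "t \<le> m * t"
    using r_le_m r_ge_2 by (cases m) auto
  have tn: "t \<le> n"
    using adm by (simp add: admissible_def)
  have "real t * ((1 - 2 * u) * ?D) \<le> real t * real ((n - t) choose (r - 1))"
    using binomial_window'(1)[of "n - t"] diff_le_mono2[OF t] by (intro mult_left_mono) auto
  also have "\<dots> \<le> real (n choose r) - real ((n - t) choose r)"
    using tn r_ge_2 by (intro binomial_diff_ge) auto
  finally have star: "real t * ((1 - 2 * u) * ?D) \<le> real (n choose r) - real ((n - t) choose r)" .
  have "real (n - t - (n - m * t)) = (real m - 1) * real t"
    using t mt_le(2) by (simp add: of_nat_diff algebra_simps)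
  then have ex: "(real m - 1) * real t * ((p - 11 * u) * ?D)
      \<le> real (ex_num r (n - t) F) - real (ex_num r (n - m * t) F)"
    using ex_num_window[of "n - m * t" "n - t"] t by (metis diff_le_mono2 diff_le_self order_refl)
  \<comment> \<open>Writing 1 as \<open>p + 64 * m * u\<close> distributes the leading term over
    \<open>m\<close> vertices and leaves \<open>64 - 11 = 53\<close> error units for each.\<close>
  have coeff: "1 - 2 * u + (real m - 1) * (p - 11 * u) = real m * (p + 53 * u) + 9 * u"
    using u_eq by (simp add: algebra_simps)
  have "real t * ((1 - 2 * u) * ?D) + (real m - 1) * real t * ((p - 11 * u) * ?D)
      = real t * ?D * (1 - 2 * u + (real m - 1) * (p - 11 * u))"
    by (simp add: algebra_simps)
  also have "\<dots> = real (m * t) * ((p + 53 * u) * ?D) + 9 * u * real t * ?D"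
    unfolding coeff by (simp add: algebra_simps)
  finally have "real t * ((1 - 2 * u) * ?D) + (real m - 1) * real t * ((p - 11 * u) * ?D)
      = real (m * t) * ((p + 53 * u) * ?D) + 9 * u * real t * ?D" .
  moreover have "0 \<le> 9 * u * real t * ?D"
    using u_pos by simp
  ultimately show ?thesis
    using star ex by linarith
qed

section \<open>High-degree vertices and copies of F\<close>

text \<open>If all degrees were at most \<open>p + 18 * u\<close> units, deleting \<open>W\<close>
  would cost no more than the gap, leaving more than \<open>ex_num r (n - m * t) F\<close> edges and
  hence a copy.\<close>

lemma missing_copy_imp_big_vertex:
  assumes G: "rgraph r (G :: 'v hypergraph)" "card (verts G) = n"
    and size: "real (card (edges G)) > real (n choose r) - real ((n - t) choose r) + real (ex_num r (n - t) F)"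
    and W: "W \<subseteq> verts G" "card W = m * t" and free: "\<not> contains_copy F (induced G (verts G - W))"
  shows "\<exists>v\<in>verts G. (p + 18 * u) * real (n choose (r - 1)) < real (degree G v)"
proof (rule ccontr)
  let ?D = "real (n choose (r - 1))" and ?G' = "induced G (verts G - W)"
  assume "\<not> (\<exists>v\<in>verts G. (p + 18 * u) * ?D < real (degree G v))"
  then have "(\<Sum>w\<in>W. real (degree G w)) \<le> (\<Sum>w\<in>W. (p + 18 * u) * ?D)"
    using W(1) by (intro sum_mono) (auto simp: not_less)
  then have "real (\<Sum>w\<in>W. degree G w) \<le> real (m * t) * ((p + 18 * u) * ?D)"
    using W(2) by simp
  also have "\<dots> \<le> real (m * t) * ((p + 53 * u) * ?D)"
    using u_pos by (intro mult_left_mono mult_right_mono) auto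
  finally have degrees: "real (\<Sum>w\<in>W. degree G w) \<le> real (m * t) * ((p + 53 * u) * ?D)" .
  have "card (verts ?G') = n - m * t"
    using G W by (simp add: card_Diff_subset rgraph_def finite_subset)
  then have "card (edges ?G') \<le> ex_num r (n - m * t) F"
    using card_edges_le_ex_num[OF rgraph_F rgraph_induced[OF G(1)] free] by simp
  moreover have "real (card (edges G)) \<le> real (card (edges ?G')) + real (\<Sum>w\<in>W. degree G w)"
    using card_edges_delete_le[OF G(1) W(1)] by (metis of_nat_add of_nat_le_iff)
  ultimately show False
    using size size_gap degrees by linarith
qed

text \<open>By the gap, deleting \<open>W\<close> leaves the average degree within \<open>c\<close> of extremal, so the surviving
  high degree of \<open>v\<close> contradicts boundedness.\<close>
lemma big_vertex_imp_copy:
  assumes G: "rgraph r (G :: 'v hypergraph)" "card (verts G) = n"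
    and size: "real (card (edges G)) > real (n choose r) - real ((n - t) choose r) + real (ex_num r (n - t) F)"
    and v: "v \<in> verts G" "(p + 18 * u) * real (n choose (r - 1)) < real (degree G v)"
    and W: "W \<subseteq> verts G - {v}" "card W = m * t"
  shows "contains_copy F (induced G (verts G - W))"
proof (rule ccontr)
  let ?D = "real (n choose (r - 1))" and ?G' = "induced G (verts G - W)" and ?n' = "n - m * t"
  let ?D' = "real (?n' choose (r - 1))"
  assume free: "\<not> contains_copy F ?G'"
  have fin: "finite (verts G)" "finite W"
    using G W by (auto simp: rgraph_def intro: finite_subset)
  have WV: "W \<subseteq> verts G"
    using W by auto
  have n': "card (verts ?G') = ?n'" "N \<le> ?n'"
    using G(2) WV W(2) fin N_le[of ?n'] by (auto simp: card_Diff_subset)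
  have n'_real: "0 < real ?n'" "real n \<le> 2 * real ?n'"
    using N_le_imp_pos[OF n'(2)] mt_le(2) by linarith+
  have G': "rgraph r ?G'"
    by (rule rgraph_induced[OF G(1)]) auto
  have "1 / 2 * ?D \<le> (1 - 2 * u) * ?D"
    using u_small by (intro mult_right_mono) auto
  then have D: "?D \<le> 2 * ?D'"
    using binomial_window'(1)[of ?n'] by simp

  \<comment> \<open>The trivial degree bound suffices for the deleted vertices: the resulting loss
    is absorbed by the tolerance \<open>c\<close> in the average degree.\<close>
  have "(\<Sum>w\<in>W. real (degree G w)) \<le> (\<Sum>w\<in>W. ?D)"
  proof (rule sum_mono)
    fix w assume "w \<in> W"
    then have "degree G w \<le> (n - 1) choose (r - 1)"
      using degree_le[OF G(1)] WV G(2) by auto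
    also have "\<dots> \<le> n choose (r - 1)"
      by (rule binomial_right_mono) simp
    finally show "real (degree G w) \<le> ?D"
      by simp
  qed
  then have "real (\<Sum>w\<in>W. degree G w) \<le> real (m * t) * ?D"
    using W(2) by simp
  moreover have "real (card (edges G)) \<le> real (card (edges ?G')) + real (\<Sum>w\<in>W. degree G w)"
    using card_edges_delete_le[OF G(1) WV] by (metis of_nat_add of_nat_le_iff)
  moreover have "0 \<le> real (m * t) * ((p + 53 * u) * ?D)"
    using p_pos u_pos by simp
  ultimately have edges: "real (ex_num r ?n' F) - real (m * t) * ?D \<le> real (card (edges ?G'))"
    using size size_gap by linarith
  \<comment> \<open>The factor 4 in \<open>admissible\<close> pays for the two factors of 2 in
    passing from \<open>n\<close> and \<open>?D\<close> to \<open>?n'\<close> and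
    \<open>?D'\<close>.\<close>
  have "4 * (real r * (real (m * t) * ?D)) \<le> c * real n * ?D"
    using adm mult_right_mono[of "4 * real r * real m * real t" "c * real n" ?D]
    by (simp add: admissible_def mult.assoc)
  also have "\<dots> \<le> c * (2 * real ?n') * (2 * ?D')"
    using n'_real(2) D c_pos by (intro mult_mono mult_left_mono) auto
  finally have "real r * (real (m * t) * ?D) \<le> c * real ?n' * ?D'"
    by simp
  then have "real r * (real (m * t) * ?D) / real ?n' \<le> c * ?D'"
    unfolding pos_divide_le_eq[OF n'_real(1)] by (simp only: mult_ac)
  then have "d_ex r ?n' F - c * ?D' \<le> real r * (real (ex_num r ?n' F) - real (m * t) * ?D) / real ?n'"
    by (simp add: d_ex_def right_diff_distrib diff_divide_distrib)
  also have "\<dots> \<le> avg_degree ?G'"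
    unfolding avg_degree_eq[OF G'] n'(1) using edges by (intro divide_right_mono mult_left_mono) auto
  finally have avg: "d_ex r ?n' F - c * ?D' \<le> avg_degree ?G'" .

  \<comment> \<open>The surviving degree of \<open>v\<close> is at most
    \<open>p + u + 16 * u\<close> units. Deleting \<open>W\<close> removes at most one further
    \<open>u\<close> from it, as shown next, which contradicts the threshold
    \<open>p + 18 * u\<close>.\<close>
  have "16 * u * ?D' \<le> 16 * u * ?D"
    using binomial_window'(3)[of ?n'] u_pos by (intro mult_left_mono) auto
  moreover have "real (degree ?G' v) \<le> d_ex r ?n' F + 16 * u * ?D'"
    using degree_bounded[OF G', of v] n' free avg v W(1) by auto
  ultimately have upper: "real (degree ?G' v) \<le> (p + 17 * u) * ?D"
    using d_ex_window(2)[of ?n'] by (simp add: algebra_simps)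

  have "real n * real ((n - 1) choose (r - 2)) = real (r - 1) * ?D"
  proof -
    have "(r - 1) * (n choose (r - 1)) = n * ((n - 1) choose (r - 2))"
      using times_binomial_minus1_eq[of "r - 1" n] r_ge_2 by (simp add: numeral_2_eq_2)
    then show ?thesis
      by (simp only: flip: of_nat_mult)
  qed
  then have "real (m * t) * real ((n - 1) choose (r - 2)) = real (m * t) * real (r - 1) / real n * ?D"
    using n_pos by (simp add: field_simps)
  also have "\<dots> \<le> u * ?D"
  proof (intro mult_right_mono)
    have "real (m * t) * real (r - 1) \<le> real (m * t) * real r"
      by (intro mult_left_mono) auto
    also have "\<dots> \<le> u * real n"
      using adm by (simp add: admissible_def mult_ac)
    finally show "real (m * t) * real (r - 1) / real n \<le> u"
      using n_pos by (simp add: pos_divide_le_eq)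
  qed simp
  finally have "real (m * t) * real ((n - 1) choose (r - 2)) \<le> u * ?D" .
  moreover have "real (degree G v) \<le> real (degree ?G' v) + real (m * t) * real ((n - 1) choose (r - 2))"
    using degree_delete_le[OF G(1) W(1) v(1) r_ge_2] W(2) G(2) by (metis of_nat_add of_nat_le_iff of_nat_mult)
  ultimately show False
    using upper v(2) by (simp add: algebra_simps)
qed

end

section \<open>The induction\<close>

text \<open>The index set is an arbitrary finite set, because the index removed in the inductive
  step is whichever one has a high-degree vertex.\<close>

lemma rainbow_matching_exists:
  fixes H :: "'i \<Rightarrow> 'v hypergraph"
  assumes "admissible n t" "finite I" "card I = Suc t" "finite V" "card V = n"
    and "\<And>i. i \<in> I \<Longrightarrow> rgraph r (H i)" "\<And>i. i \<in> I \<Longrightarrow> verts (H i) = V"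
    and "\<And>i. i \<in> I \<Longrightarrow> real (card (edges (H i)))
           > real (n choose r) - real ((n - t) choose r) + real (ex_num r (n - t) F)"
  shows "rainbow_matching F I V H"
  using assms
proof (induction t arbitrary: n I V H)
  case 0
  show ?case
  proof (rule rainbow_matching_greedy[OF rgraph_F "0.prems"(2,4)])
    fix i W assume i: "i \<in> I" and W: "W \<subseteq> V" "card W = card (verts F) * (card I - 1)"
    have "W = {}"
      using W "0.prems"(3,4) finite_subset[OF W(1)] by simp
    then show "contains_copy F (induced (H i) (V - W))"
      \<comment> \<open>With \<open>t = 0\<close> both lemmas apply to the empty set: a missing copy
        would produce a high-degree vertex, and that vertex forces a copy.\<close>
      using missing_copy_imp_big_vertex[OF "0.prems"(1) "0.prems"(6)[OF i], of "{}"]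
        big_vertex_imp_copy[OF "0.prems"(1) "0.prems"(6)[OF i], of _ "{}"]
        "0.prems"(5) "0.prems"(7,8)[OF i] by auto
  qed (simp add: "0.prems"(3))
next
  case (Suc t n I V H)
  show ?case
  proof (cases "\<exists>i\<in>I. \<exists>v\<in>V. (p + 18 * u) * real (n choose (r - 1)) < real (degree (H i) v)")
    case True
    then obtain i v where iv: "i \<in> I" "v \<in> V" "(p + 18 * u) * real (n choose (r - 1)) < real (degree (H i) v)"
      by blast
    let ?V = "V - {v}" and ?H = "\<lambda>j. induced (H j) (V - {v})"
    obtain k where n: "n = Suc k"
      using Suc.prems(4,5) iv(2) by (cases n) auto
    have J: "finite (I - {i})" "card (I - {i}) = Suc t" "i \<notin> I - {i}" "insert i (I - {i}) = I"
      using Suc.prems(2,3) iv(1) by auto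
    have "rainbow_matching F (I - {i}) ?V ?H"
    proof (rule Suc.IH)
      show "admissible k t"
        using Suc.prems(1) n admissible_Suc by simp
      show "finite (I - {i})" "card (I - {i}) = Suc t" "finite ?V" "card ?V = k"
        using J Suc.prems n iv(2) by auto
      fix j assume "j \<in> I - {i}"
      then have j: "j \<in> I"
        by simp
      show "rgraph r (?H j)"
        using Suc.prems(6,7)[OF j] by (intro rgraph_induced) auto
      \<comment> \<open>The required edge count drops by exactly \<open>k choose (r - 1)\<close>
        from \<open>(n, Suc t)\<close> to \<open>(k, t)\<close>, as Pascal's rule shows with
        \<open>n - Suc t = k - t\<close>. Deleting \<open>v\<close> costs at most that much.\<close>
      have "card (edges (H j)) \<le> card (edges (?H j)) + degree (H j) v"
        using card_edges_delete_le[OF Suc.prems(6)[OF j], of "{v}"] Suc.prems(7)[OF j] iv(2) by simp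
      moreover have "degree (H j) v \<le> k choose (r - 1)"
        using degree_le[OF Suc.prems(6)[OF j]] Suc.prems(5) Suc.prems(7)[OF j] iv(2) n by auto
      moreover have "n choose r = (k choose (r - 1)) + (k choose r)"
        using n r_ge_2 by (cases r) auto
      ultimately show "real (card (edges (?H j)))
          > real (k choose r) - real ((k - t) choose r) + real (ex_num r (k - t) F)"
        using Suc.prems(8)[OF j] n by simp
    qed simp
    then have "rainbow_matching F (I - {i}) ?V H"
      by (rule rainbow_matching_induced)
    then have "rainbow_matching F (insert i (I - {i})) V H"
    proof (rule rainbow_matching_insert[OF rgraph_F J(1,3)])
      fix U assume "U \<subseteq> ?V" "card U = card (verts F) * card (I - {i})"
      then show "contains_copy F (induced (H i) (V - U))"
        using big_vertex_imp_copy[OF Suc.prems(1) Suc.prems(6)[OF iv(1)], of v U]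
          Suc.prems(5) Suc.prems(7,8)[OF iv(1)] iv(2,3) J(2) card_F by simp
    qed auto
    then show ?thesis
      by (simp only: J(4))
  next
    case False
    show ?thesis
    proof (rule rainbow_matching_greedy[OF rgraph_F Suc.prems(2,4)])
      show "card (verts F) * (card I - 1) \<le> card V"
        using mt_le(2)[OF Suc.prems(1)] Suc.prems(3,5) card_F by simp
      fix i W assume i: "i \<in> I" "W \<subseteq> V" "card W = card (verts F) * (card I - 1)"
      show "contains_copy F (induced (H i) (V - W))"
      proof (rule ccontr)
        assume "\<not> contains_copy F (induced (H i) (V - W))"
        then have "\<exists>v\<in>V. (p + 18 * u) * real (n choose (r - 1)) < real (degree (H i) v)"
          using missing_copy_imp_big_vertex[OF Suc.prems(1) Suc.prems(6)[OF i(1)], of W]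
            Suc.prems(3,5) Suc.prems(7,8)[OF i(1)] i(2,3) card_F by simp
        then show False
          using False i(1) by blast
      qed
    qed
  qed
qed

end

section \<open>Choice of constants and conclusion\<close>

theorem theorem1p8:
  fixes F :: "'a hypergraph" and m r :: nat and c :: real
  assumes "m \<ge> r" and "r \<ge> 2"
    and "rgraph r F" and "card (verts F) = m" and "nondegenerate r F"
    and "c > 0"
    and "\<forall>\<^sub>F n in sequentially.
           \<forall>H :: nat hypergraph.
             rgraph r H \<and> card (verts H) = n \<and> \<not> contains_copy F H \<and>
             avg_degree H \<ge> d_ex r n F - c * real (n choose (r - 1)) \<longrightarrow>
             real (max_degree H)
               \<le> d_ex r n F + (1 - turan_density r F) / (4 * real m) * real (n choose (r - 1))"
    and "\<forall>\<^sub>F n in sequentially.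
           \<bar>delta_ex r n F - d_ex r (n - 1) F\<bar>
             \<le> (1 - turan_density r F) / (8 * real m) * real (n choose (r - 1))"
  shows "\<exists>N0 :: nat. \<forall>n\<ge>N0. \<forall>t :: nat.
           real t \<le> min (c / (4 * exp 1 * real r * real m) * real n)
                        ((1 - turan_density r F) / (64 * real r * (real m)\<^sup>2) * real n) \<longrightarrow>
           (\<forall>(V :: 'v set) (H :: nat \<Rightarrow> 'v hypergraph).
              finite V \<and> card V = n \<and>
              (\<forall>i\<in>{1..t + 1}. rgraph r (H i) \<and> verts (H i) = V \<and>
                 real (card (edges (H i)))
                   > real (n choose r) - real ((n - t) choose r) + real (ex_num r (n - t) F)) \<longrightarrow>
              rainbow_matching F {1..t + 1} V H)"
proof (cases "turan_density r F < 1")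
  case False
  \<comment> \<open>Here the bound on \<open>t\<close> is nonpositive, so \<open>t = 0\<close>, and
    a single hypergraph with more than \<open>ex_num r n F\<close> edges has to contain a
    copy.\<close>
  show ?thesis
  proof (intro exI allI impI)
    fix n t :: nat and V :: "'v set" and H :: "nat \<Rightarrow> 'v hypergraph"
    assume t: "real t \<le> min (c / (4 * exp 1 * real r * real m) * real n)
          ((1 - turan_density r F) / (64 * real r * (real m)\<^sup>2) * real n)"
      and H: "finite V \<and> card V = n \<and>
              (\<forall>i\<in>{1..t + 1}. rgraph r (H i) \<and> verts (H i) = V \<and>
                 real (card (edges (H i)))
                   > real (n choose r) - real ((n - t) choose r) + real (ex_num r (n - t) F))"
    have "(1 - turan_density r F) / (64 * real r * (real m)\<^sup>2) * real n \<le> 0"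
      using False by (intro mult_nonpos_nonneg divide_nonpos_nonneg) auto
    then have "t = 0"
      using t by simp
    show "rainbow_matching F {1..t + 1} V H"
    proof (rule rainbow_matching_greedy[OF assms(3)])
      fix i W assume i: "i \<in> {1..t + 1}" and "W \<subseteq> V" "card W = card (verts F) * (card {1..t + 1} - 1)"
      then have "W = {}"
        using H \<open>t = 0\<close> finite_subset[of W V] by simp
      moreover have "rgraph r (H i)" "verts (H i) = V" "ex_num r n F < card (edges (H i))"
        using H i \<open>t = 0\<close> by auto
      then have "contains_copy F (H i)"
        using card_edges_le_ex_num[OF assms(3), of r "H i"] H not_le by blast
      moreover have "{e \<in> edges (H i). e \<subseteq> V} = edges (H i)"
        using rgraph_edgeD(1)[OF \<open>rgraph r (H i)\<close>] \<open>verts (H i) = V\<close> by auto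
      ultimately show "contains_copy F (induced (H i) (V - W))"
        using \<open>verts (H i) = V\<close> by (auto intro: contains_copy_mono)
    qed (use H \<open>t = 0\<close> in auto)
  qed
next
  case True
  \<comment> \<open>With this unit the constants in the two hypotheses are \<open>16 * u\<close> and
    \<open>8 * u\<close>, and the second bound on \<open>t\<close> reads
    \<open>r * m * t \<le> u * n\<close>.\<close>
  define u where "u = (1 - turan_density r F) / (64 * real m)"
  have m: "0 < real m" and r: "0 < real r"
    using assms(1,2) by auto
  have u: "0 < u" "64 * real m * u = 1 - turan_density r F"
    using True m by (simp_all add: u_def)
  have edges: "edges F \<noteq> {}"
    using nondegenerate_imp_edges[OF assms(3) _ assms(5)] assms(2) by simp
  have "\<forall>\<^sub>F n in sequentially. dist (real (ex_num r n F) / real (n choose r)) (turan_density r F) < u"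
    using turan_density_limit[OF assms(3) edges] u(1) by (rule tendstoD)
  then have density: "\<forall>\<^sub>F n in sequentially.
      \<bar>real (ex_num r n F) - turan_density r F * real (n choose r)\<bar> \<le> u * real (n choose r)"
    using eventually_ge_at_top[of r]
  proof eventually_elim
    case (elim n)
    let ?C = "real (n choose r)"
    have C: "0 < ?C"
      using elim(2) by simp
    have "\<bar>real (ex_num r n F) - turan_density r F * ?C\<bar> = \<bar>real (ex_num r n F) / ?C - turan_density r F\<bar> * ?C"
      using C abs_mult_pos[of ?C "real (ex_num r n F) / ?C - turan_density r F"]
      by (simp add: left_diff_distrib)
    also have "\<dots> \<le> u * ?C"
      using elim(1) C by (intro mult_right_mono) (auto simp: dist_real_def)
    finally show ?case .
  qed
  have "\<forall>\<^sub>F n in sequentially. real r \<le> u * real n"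
    using u(1) by (intro eventually_mono[OF eventually_ge_at_top[of "nat \<lceil>real r / u\<rceil>"]])
      (simp add: ceiling_le_iff pos_divide_le_eq mult.commute)
  from eventually_conj[OF eventually_conj[OF assms(7,8)] eventually_conj[OF density this]]
  obtain N where N: "\<And>n. N \<le> n \<Longrightarrow> (\<forall>H :: nat hypergraph.
             rgraph r H \<and> card (verts H) = n \<and> \<not> contains_copy F H \<and>
             avg_degree H \<ge> d_ex r n F - c * real (n choose (r - 1)) \<longrightarrow>
             real (max_degree H)
               \<le> d_ex r n F + (1 - turan_density r F) / (4 * real m) * real (n choose (r - 1)))"
    "\<And>n. N \<le> n \<Longrightarrow> \<bar>delta_ex r n F - d_ex r (n - 1) F\<bar>
             \<le> (1 - turan_density r F) / (8 * real m) * real (n choose (r - 1))"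
    "\<And>n. N \<le> n \<Longrightarrow> \<bar>real (ex_num r n F) - turan_density r F * real (n choose r)\<bar> \<le> u * real (n choose r)"
    "\<And>n. N \<le> n \<Longrightarrow> real r \<le> u * real n"
    unfolding eventually_sequentially by blast
  have u': "(1 - turan_density r F) / (4 * real m) = 16 * u" "(1 - turan_density r F) / (8 * real m) = 8 * u"
    using m by (simp_all add: u_def field_simps)
  interpret turan_regime F r m N c "turan_density r F" u
  proof
    show "0 < turan_density r F"
      using assms(5) by (simp add: nondegenerate_def)
  qed (use assms u N u' in auto)
  show ?thesis
  \<comment> \<open>The bound on \<open>t\<close> gives \<open>2 * t \<le> n\<close>, so
    \<open>4 * N \<le> n\<close> yields \<open>2 * N \<le> n - t\<close>, as
    \<open>admissible\<close> demands.\<close>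
  proof (intro exI[of _ "4 * N"] allI impI)
    fix n t :: nat and V :: "'v set" and H :: "nat \<Rightarrow> 'v hypergraph"
    assume n: "4 * N \<le> n"
      and t: "real t \<le> min (c / (4 * exp 1 * real r * real m) * real n)
          ((1 - turan_density r F) / (64 * real r * (real m)\<^sup>2) * real n)"
      and H: "finite V \<and> card V = n \<and>
              (\<forall>i\<in>{1..t + 1}. rgraph r (H i) \<and> verts (H i) = V \<and>
                 real (card (edges (H i)))
                   > real (n choose r) - real ((n - t) choose r) + real (ex_num r (n - t) F))"
    have "(1 - turan_density r F) / (64 * real r * (real m)\<^sup>2) * real n = u * real n / (real r * real m)"
      by (simp add: u_def power2_eq_square)
    then have "real t \<le> u * real n / (real r * real m)"
      using t by simp
    then have rmt: "real r * real m * real t \<le> u * real n"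
      using m r by (simp add: pos_le_divide_eq mult_ac)
    have "real t \<le> c * real n / (4 * exp 1 * real r * real m)"
      using t by simp
    then have "exp 1 * (4 * real r * real m * real t) \<le> c * real n"
      using m r by (simp add: pos_le_divide_eq mult_ac)
    moreover have "1 * (4 * real r * real m * real t) \<le> exp 1 * (4 * real r * real m * real t)"
      by (intro mult_right_mono) auto
    ultimately have c: "4 * real r * real m * real t \<le> c * real n"
      by linarith
    have "1 * real t \<le> (real r * real m) * real t"
      using m r mult_mono[of 1 "real r" 1 "real m"] by (intro mult_right_mono) auto
    also have "\<dots> \<le> 1 / 2 * real n"
      using rmt u_small mult_right_mono[of u "1 / 2" "real n"] u(1) by linarith
    finally have "2 * t \<le> n"
      by linarith
    then have "admissible n t"
      using n rmt c by (simp add: admissible_def)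
    then show "rainbow_matching F {1..t + 1} V H"
      using H by (intro rainbow_matching_exists) auto
  qed
qed

end
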